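(* Let $1/2 < p \le 1$, let $0<\varepsilon<1$, let $n\ge 1$ be an integer, and let $X(0), X(1), \dots$ be i.i.d. random variables with $P(X(k)=1)=p$ and $P(X(k)=-1)=1-p$. Put $\mathcal{X}_n = \prod_{k=0}^{n-1}(1+X(k)) - 1$ and, for $K\in\mathcal{K}_\varepsilon = \left[0,\frac{1}{1+\varepsilon}\right]$, put $$g_{n,\varepsilon}(K) = \frac{1}{n}\mathbb{E}\left[\log\left(1+K(\mathcal{X}_n-\varepsilon)\right)\right].$$ Let $g_{n,\varepsilon}^* = \max_{K\in\mathcal{K}_\varepsilon} g_{n,\varepsilon}(K)$ and let $K_{n,\varepsilon}^*$ denote the maximizer (the optimal Kelly fraction). If $$p \le p_\varepsilon = \left(\frac{1+\varepsilon}{2^n}\right)^{1/n},$$ then $K_{n,\varepsilon}^*=0$ and $g_{n,\varepsilon}^*=0$. Otherwise, $$K_{n,\varepsilon}^* = \frac{2^np^n-\varepsilon-1}{(\varepsilon+1)(2^n-\varepsilon-1)}$$ and $$g_{n,\varepsilon}^* = \frac{1}{n}\left[p^n\log\left(\frac{2^np^n}{\varepsilon+1}\right) + (1-p^n)\log\left(\frac{2^n(1-p^n)}{2^n-\varepsilon-1}\right)\right].$$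
   Context: Here $\log$ is the natural logarithm, with $\log 0=-\infty$ (so $g_{n,\varepsilon}$ may take the value $-\infty$) and $0\cdot\log 0=0$ (relevant only when $p=1$). Interpretation: a bettor wagers the fraction $K$ of wealth on an even-money coin flip with winning probability $p$, lets proceeds ride for $n$ flips between bet updates, and pays a proportional transaction cost $\varepsilon$ times the bet size at each update; the interest rate on idle cash is zero. The constraint $K\le 1/(1+\varepsilon)$ ensures that the account value stays nonnegative. *)

theory Defs
  imports "HOL-Probability.Probability"
begin

(* HOL sets ln 0 = 0, so the convention log 0 = -\<infinity> needs an extended-real-valued logarithm.
   Negative arguments are irrelevant: for K in the admissible range the argument is
   almost surely nonnegative. *)
definition elog :: "real \<Rightarrow> ereal" where
  "elog x = (if 0 < x then ereal (ln x) else - \<infinity>)"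

(* The Bochner integral only covers integrable real-valued functions, so the expectation of an
   extended-real-valued f is taken as E[f^+] - E[f^-].  This is meaningful whenever
   at least one of the two parts is finite; for the functions below E[f^+] is always finite. *)
definition eexpectation :: "'a measure \<Rightarrow> ('a \<Rightarrow> ereal) \<Rightarrow> ereal" where
  "eexpectation M f =
     enn2ereal (\<integral>\<^sup>+ \<omega>. e2ennreal (f \<omega>) \<partial>M) - enn2ereal (\<integral>\<^sup>+ \<omega>. e2ennreal (- f \<omega>) \<partial>M)"

definition compound_return :: "(nat \<Rightarrow> 'a \<Rightarrow> real) \<Rightarrow> nat \<Rightarrow> 'a \<Rightarrow> real" where
  "compound_return X n \<omega> = (\<Prod>k<n. 1 + X k \<omega>) - 1"

definition admissible :: "real \<Rightarrow> real set" where
  "admissible \<epsilon> = {0 .. 1 / (1 + \<epsilon>)}"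

definition growth_rate ::
  "'a measure \<Rightarrow> (nat \<Rightarrow> 'a \<Rightarrow> real) \<Rightarrow> nat \<Rightarrow> real \<Rightarrow> real \<Rightarrow> ereal" where
  "growth_rate M X n \<epsilon> K =
     ereal (1 / real n) * eexpectation M (\<lambda>\<omega>. elog (1 + K * (compound_return X n \<omega> - \<epsilon>)))"

(* A supremum by definition; that it is a maximum is a claim to be proved. *)
definition optimal_growth_rate ::
  "'a measure \<Rightarrow> (nat \<Rightarrow> 'a \<Rightarrow> real) \<Rightarrow> nat \<Rightarrow> real \<Rightarrow> ereal" where
  "optimal_growth_rate M X n \<epsilon> = (SUP K \<in> admissible \<epsilon>. growth_rate M X n \<epsilon> K)"

definition is_kelly_fraction ::
  "'a measure \<Rightarrow> (nat \<Rightarrow> 'a \<Rightarrow> real) \<Rightarrow> nat \<Rightarrow> real \<Rightarrow> real \<Rightarrow> bool" where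
  "is_kelly_fraction M X n \<epsilon> K \<longleftrightarrow>
     is_arg_max (growth_rate M X n \<epsilon>) (\<lambda>K. K \<in> admissible \<epsilon>) K"

(* Meaningful only once existence and uniqueness of the maximizer are known. *)
definition kelly_fraction ::
  "'a measure \<Rightarrow> (nat \<Rightarrow> 'a \<Rightarrow> real) \<Rightarrow> nat \<Rightarrow> real \<Rightarrow> real" where
  "kelly_fraction M X n \<epsilon> = (THE K. is_kelly_fraction M X n \<epsilon> K)"

definition p_threshold :: "nat \<Rightarrow> real \<Rightarrow> real" where
  "p_threshold n \<epsilon> = ((1 + \<epsilon>) / 2 ^ n) powr (1 / real n)"

end

theory Submission
  imports Defs
begin

text \<open>Almost surely, the compound return takes only two values: \<open>2 ^ n - 1\<close> with probability
  \<open>p ^ n\<close>, if every flip is won, and \<open>-1\<close> otherwise. The growth rate is thus a two-point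
  expectation \<open>q * ln U + (1 - q) * ln V\<close> with \<open>U\<close> and \<open>V\<close> affine in \<open>K\<close>. It is bounded by
  the tangent inequality \<open>ln x < x - 1\<close> for \<open>x \<noteq> 1\<close>, applied to the ratios of \<open>U\<close> and \<open>V\<close> to
  their values at the claimed maximizer; its strictness gives uniqueness.\<close>

lemma ln_less_minus_one:
  fixes x :: real
  assumes "0 < x" "x \<noteq> 1"
  shows "ln x < x - 1"
  using assms ln_le_minus_one[of x] ln_eq_minus_one[of x] by fastforce

section \<open>Expectations of functions with two values\<close>

context prob_space
begin

lemma nn_integral_two_valued:
  assumes A: "A \<in> events"
    and f: "AE \<omega> in M. f \<omega> = (if \<omega> \<in> A then u else v)"
  shows "(\<integral>\<^sup>+\<omega>. f \<omega> \<partial>M) = u * ennreal (prob A) + v * ennreal (1 - prob A)"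
proof -
  have "(\<integral>\<^sup>+\<omega>. f \<omega> \<partial>M)
      = (\<integral>\<^sup>+\<omega>. u * indicator A \<omega> + v * indicator (space M - A) \<omega> \<partial>M)"
    using f AE_space by (intro nn_integral_cong_AE) (auto simp: indicator_def)
  also have "\<dots> = u * emeasure M A + v * emeasure M (space M - A)"
    using A by (subst nn_integral_add) (auto simp: nn_integral_cmult_indicator)
  finally show ?thesis
    using A by (simp add: emeasure_eq_measure prob_compl)
qed

text \<open>The positive and negative parts of \<open>f\<close> are themselves two-valued and have
  finite integrals, and \<open>max 0 x - max 0 (- x) = x\<close> recombines them.\<close>

lemma eexpectation_two_valued:
  assumes A: "A \<in> events"
    and f: "AE \<omega> in M. f \<omega> = (if \<omega> \<in> A then ereal x else ereal y)"
  shows "eexpectation M f = ereal (prob A * x + (1 - prob A) * y)"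
proof -
  have split: "(\<integral>\<^sup>+\<omega>. e2ennreal (g \<omega>) \<partial>M)
      = ennreal (max 0 a * prob A + max 0 b * (1 - prob A))"
    if "AE \<omega> in M. g \<omega> = (if \<omega> \<in> A then ereal a else ereal b)" for g a b
  proof -
    \<comment> \<open>\<open>e2ennreal\<close> sends negative values to 0, so it produces the
      positive part of \<open>g\<close>. Taking \<open>g\<close> to be \<open>f\<close> and then
      \<open>- f\<close> covers both parts.\<close>
    have e: "e2ennreal (ereal r) = ennreal (max 0 r)" for r
      by (simp add: ennreal_neg max_def)
    have "AE \<omega> in M. e2ennreal (g \<omega>)
        = (if \<omega> \<in> A then ennreal (max 0 a) else ennreal (max 0 b))"
      using that by eventually_elim (auto simp: e)
    from nn_integral_two_valued[OF A this] show ?thesis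
      by (simp add: ennreal_mult ennreal_plus)
  qed
  have neg: "AE \<omega> in M. - f \<omega> = (if \<omega> \<in> A then ereal (- x) else ereal (- y))"
    using f by eventually_elim auto
  have "eexpectation M f = ereal ((max 0 x * prob A + max 0 y * (1 - prob A))
      - (max 0 (- x) * prob A + max 0 (- y) * (1 - prob A)))"
    \<comment> \<open>Each sum stays inside a single \<open>ennreal\<close>, so that
      \<open>enn2ereal\<close> turns it back into a real number.\<close>
    unfolding eexpectation_def split[OF f] split[OF neg] by (simp del: ennreal_plus)
  also have "\<dots> = ereal (prob A * x + (1 - prob A) * y)"
    by (auto simp: max_def algebra_simps)
  finally show ?thesis .
qed

text \<open>The complement of \<open>A\<close> has positive probability, so the negative part has
  infinite integral, while the positive part has a finite one.\<close>

lemma eexpectation_two_valued_minus_infinity: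
  assumes A: "A \<in> events" and "prob A < 1"
    and f: "AE \<omega> in M. f \<omega> = (if \<omega> \<in> A then ereal x else -\<infinity>)"
  shows "eexpectation M f = -\<infinity>"
proof -
  have "AE \<omega> in M. e2ennreal (f \<omega>) = (if \<omega> \<in> A then e2ennreal (ereal x) else 0)"
    using f by eventually_elim (auto simp: e2ennreal_neg)
  from nn_integral_two_valued[OF A this]
  have pos: "(\<integral>\<^sup>+\<omega>. e2ennreal (f \<omega>) \<partial>M) \<noteq> \<top>"
    by (auto simp: ennreal_mult_eq_top_iff)
  have "AE \<omega> in M. e2ennreal (- f \<omega>) = (if \<omega> \<in> A then e2ennreal (ereal (- x)) else \<top>)"
    using f by eventually_elim auto
  from nn_integral_two_valued[OF A this]
  have "(\<integral>\<^sup>+\<omega>. e2ennreal (- f \<omega>) \<partial>M) = \<top>"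
    using \<open>prob A < 1\<close> by (simp add: ennreal_top_mult)
  with pos show ?thesis
    unfolding eexpectation_def
    by (cases "\<integral>\<^sup>+\<omega>. e2ennreal (f \<omega>) \<partial>M") auto
qed

section \<open>The growth rate of the coin in closed form\<close>

lemma prob_all_wins:
  assumes "indep_vars (\<lambda>_. borel) X UNIV" and "n \<ge> 1"
    and "\<And>k. prob {\<omega> \<in> space M. X k \<omega> = (1::real)} = p"
  shows "prob {\<omega> \<in> space M. \<forall>k<n. X k \<omega> = 1} = p ^ n"
proof -
  \<comment> \<open>Both the product rule for independent variables and the rewriting as an
    intersection need a nonempty index set.\<close>
  have "{..<n} \<noteq> {}"
    using \<open>n \<ge> 1\<close> by (auto simp: lessThan_empty_iff)
  have s: "X k -` {1} \<inter> space M = {\<omega> \<in> space M. X k \<omega> = 1}" for k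
    by auto
  have "{\<omega> \<in> space M. \<forall>k<n. X k \<omega> = 1} = (\<Inter>k\<in>{..<n}. X k -` {1} \<inter> space M)"
    using \<open>{..<n} \<noteq> {}\<close> by auto
  also have "prob \<dots> = (\<Prod>k\<in>{..<n}. prob (X k -` {1} \<inter> space M))"
    using indep_varsD[OF assms(1) \<open>{..<n} \<noteq> {}\<close>, of "\<lambda>_. {1}"] by simp
  finally show ?thesis
    by (simp add: s assms(3))
qed

text \<open>A win and a loss have total probability 1, so almost surely every flip is one of the
  two. A single loss then puts a factor 0 into the product.\<close>

lemma AE_compound_return:
  assumes [measurable]: "\<And>k. X k \<in> borel_measurable M"
    and win: "\<And>k. prob {\<omega> \<in> space M. X k \<omega> = 1} = p"
    and loss: "\<And>k. prob {\<omega> \<in> space M. X k \<omega> = -1} = 1 - p"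
  shows "AE \<omega> in M. compound_return X n \<omega> =
    (if \<omega> \<in> {\<omega> \<in> space M. \<forall>k<n. X k \<omega> = 1} then 2 ^ n - 1 else -1)"
proof -
  have "AE \<omega> in M. X k \<omega> = 1 \<or> X k \<omega> = -1" for k
  proof -
    have "prob ({\<omega> \<in> space M. X k \<omega> = 1} \<union> {\<omega> \<in> space M. X k \<omega> = -1}) = 1"
      by (subst finite_measure_Union) (auto simp: win loss)
    then have "AE \<omega> in M. \<omega> \<in> {\<omega> \<in> space M. X k \<omega> = 1} \<union> {\<omega> \<in> space M. X k \<omega> = -1}"
      by (rule AE_prob_1)
    then show ?thesis
      by eventually_elim auto
  qed
  then have "AE \<omega> in M. \<forall>k. X k \<omega> = 1 \<or> X k \<omega> = -1"
    by (simp add: AE_all_countable)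
  then show ?thesis
    using AE_space
  proof eventually_elim
    case (elim \<omega>)
    show ?case
    proof (cases "\<forall>k<n. X k \<omega> = 1")
      case True
      then show ?thesis
        using elim by (simp add: compound_return_def)
    next
      case False
      then obtain k where "k < n" "1 + X k \<omega> = 0"
        using elim by fastforce
      then have "(\<Prod>k<n. 1 + X k \<omega>) = 0"
        by (intro prod_zero) auto
      then show ?thesis
        using False by (auto simp: compound_return_def)
    qed
  qed
qed

text \<open>The separate value at the right endpoint is needed because \<open>ln 0 = 0\<close> in
  HOL, whereas \<open>elog 0\<close> is minus infinity. If \<open>p ^ n = 1\<close>, that value is
  taken only on a null set, and the weight \<open>1 - p ^ n\<close> removes it from the
  formula.\<close>

lemma growth_rate_coin:
  assumes indep: "indep_vars (\<lambda>_. borel) X UNIV" and "n \<ge> 1"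
    and win: "\<And>k. prob {\<omega> \<in> space M. X k \<omega> = 1} = p"
    and loss: "\<And>k. prob {\<omega> \<in> space M. X k \<omega> = -1} = 1 - p"
    and U: "0 < 1 + K * (2 ^ n - 1 - \<epsilon>)" and V: "0 \<le> 1 - K * (1 + \<epsilon>)"
  shows "growth_rate M X n \<epsilon> K =
    (if p ^ n < 1 \<and> 1 - K * (1 + \<epsilon>) = 0 then -\<infinity>
     else ereal (1 / real n * (p ^ n * ln (1 + K * (2 ^ n - 1 - \<epsilon>))
                               + (1 - p ^ n) * ln (1 - K * (1 + \<epsilon>)))))"
proof -
  have [measurable]: "X k \<in> borel_measurable M" for k
    using indep by (auto simp: indep_vars_def)
  define A where "A = {\<omega> \<in> space M. \<forall>k<n. X k \<omega> = 1}"
  define U where "U = 1 + K * (2 ^ n - 1 - \<epsilon>)"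
  define V where "V = 1 - K * (1 + \<epsilon>)"
  define f where "f = (\<lambda>\<omega>. elog (1 + K * (compound_return X n \<omega> - \<epsilon>)))"
  have A: "A \<in> events"
    unfolding A_def by measurable
  have pA: "prob A = p ^ n"
    unfolding A_def using indep \<open>n \<ge> 1\<close> win by (rule prob_all_wins)
  have "0 < U" "0 \<le> V"
    using assms by (simp_all add: U_def V_def)
  have "AE \<omega> in M. compound_return X n \<omega> = (if \<omega> \<in> A then 2 ^ n - 1 else -1)"
    unfolding A_def by (rule AE_compound_return) (use win loss in auto)
  then have f: "AE \<omega> in M. f \<omega> = (if \<omega> \<in> A then ereal (ln U) else elog V)"
  proof eventually_elim
    case (elim \<omega>)
    have "1 + K * (- 1 - \<epsilon>) = V"
      by (simp add: V_def algebra_simps)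
    with elim \<open>0 < U\<close> show ?case
      by (auto simp: f_def elog_def U_def)
  qed
  have g: "growth_rate M X n \<epsilon> K = ereal (1 / real n) * eexpectation M f"
    by (simp add: growth_rate_def f_def)
  consider "V > 0" | "V = 0" "p ^ n < 1" | "V = 0" "p ^ n = 1"
    using \<open>0 \<le> V\<close> prob_le_1[of A] pA by fastforce
  then show ?thesis
    unfolding U_def[symmetric] V_def[symmetric]
  proof cases
    case 1
    then have "elog V = ereal (ln V)"
      by (simp add: elog_def)
    with f have "AE \<omega> in M. f \<omega> = (if \<omega> \<in> A then ereal (ln U) else ereal (ln V))"
      by (simp only:)
    from eexpectation_two_valued[OF A this] 1
    show "growth_rate M X n \<epsilon> K = (if p ^ n < 1 \<and> V = 0 then -\<infinity> else
        ereal (1 / real n * (p ^ n * ln U + (1 - p ^ n) * ln V)))"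
      by (simp add: g pA)
  next
    case 2
    then have "elog V = -\<infinity>"
      by (simp add: elog_def)
    with f have "AE \<omega> in M. f \<omega> = (if \<omega> \<in> A then ereal (ln U) else -\<infinity>)"
      by (simp only:)
    from eexpectation_two_valued_minus_infinity[OF A _ this] 2 \<open>n \<ge> 1\<close>
    show "growth_rate M X n \<epsilon> K = (if p ^ n < 1 \<and> V = 0 then -\<infinity> else
        ereal (1 / real n * (p ^ n * ln U + (1 - p ^ n) * ln V)))"
      by (simp add: g pA)
  next
    case 3
    \<comment> \<open>Now \<open>A\<close> has full measure, so the infinite value off
      \<open>A\<close> may be replaced by any finite one, here 0.\<close>
    have "AE \<omega> in M. \<omega> \<in> A"
      using 3 pA by (intro AE_prob_1) simp
    with f have "AE \<omega> in M. f \<omega> = (if \<omega> \<in> A then ereal (ln U) else ereal 0)"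
      by eventually_elim auto
    from eexpectation_two_valued[OF A this] 3
    show "growth_rate M X n \<epsilon> K = (if p ^ n < 1 \<and> V = 0 then -\<infinity> else
        ereal (1 / real n * (p ^ n * ln U + (1 - p ^ n) * ln V)))"
      by (simp add: g pA)
  qed
qed

end

section \<open>Reduction to strict dominance, and the threshold\<close>

text \<open>A point that strictly beats every other admissible one is the only maximizer, which
  settles the \<open>THE\<close> and shows that the supremum is attained there.\<close>

lemma kelly_fraction_eqI:
  assumes "L \<in> admissible \<epsilon>"
    and "\<forall>K \<in> admissible \<epsilon> - {L}. growth_rate M X n \<epsilon> K < growth_rate M X n \<epsilon> L"
  shows "\<exists>!K. is_kelly_fraction M X n \<epsilon> K"
    and "kelly_fraction M X n \<epsilon> = L"
    and "optimal_growth_rate M X n \<epsilon> = growth_rate M X n \<epsilon> L"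
proof -
  have "is_kelly_fraction M X n \<epsilon> K \<longleftrightarrow> K = L" for K
    using assms unfolding is_kelly_fraction_def is_arg_max_linorder
    by (cases "K = L") (auto simp: not_le intro: less_imp_le)
  then show "\<exists>!K. is_kelly_fraction M X n \<epsilon> K" "kelly_fraction M X n \<epsilon> = L"
    by (auto simp: kelly_fraction_def)
  show "optimal_growth_rate M X n \<epsilon> = growth_rate M X n \<epsilon> L"
    unfolding optimal_growth_rate_def using assms
    by (intro antisym SUP_least SUP_upper) (auto intro: less_imp_le)
qed

text \<open>Writing \<open>p\<close> as \<open>root n (p ^ n)\<close> lets the monotonicity of the
  root reduce the comparison to one of radicands.\<close>

lemma le_p_threshold_iff:
  assumes "0 < p" "0 < 1 + \<epsilon>" "n \<ge> 1"
  shows "p \<le> p_threshold n \<epsilon> \<longleftrightarrow> 2 ^ n * p ^ n \<le> 1 + \<epsilon>"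
proof -
  have "p_threshold n \<epsilon> = root n ((1 + \<epsilon>) / 2 ^ n)"
    using assms by (simp add: p_threshold_def root_powr_inverse)
  then have "p \<le> p_threshold n \<epsilon> \<longleftrightarrow> root n (p ^ n) \<le> root n ((1 + \<epsilon>) / 2 ^ n)"
    using assms by (simp add: real_root_power_cancel)
  also have "\<dots> \<longleftrightarrow> 2 ^ n * p ^ n \<le> 1 + \<epsilon>"
    using assms by (simp add: field_simps)
  finally show ?thesis .
qed

section \<open>Real inequalities for the two-point log growth, with \<open>a\<close> for
  \<open>2 ^ n\<close> and \<open>q\<close> for \<open>p ^ n\<close>\<close>

text \<open>At \<open>K = 0\<close> both logarithms have argument 1, so the tangent bound there
  gives \<open>K * (a * q - (1 + e))\<close>, which is at most 0. Strictness comes from the second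
  logarithm, whose weight \<open>1 - q\<close> is positive.\<close>

lemma log_growth_less_zero:
  fixes a e q K :: real
  assumes "0 < q" "q < 1" "a * q \<le> 1 + e" "0 < K"
    and U: "0 < 1 + K * (a - 1 - e)" and V: "0 < 1 - K * (1 + e)" and "0 < 1 + e"
  shows "q * ln (1 + K * (a - 1 - e)) + (1 - q) * ln (1 - K * (1 + e)) < 0"
proof -
  have "q * ln (1 + K * (a - 1 - e)) \<le> q * (K * (a - 1 - e))"
    using ln_le_minus_one[OF U] \<open>0 < q\<close> by simp
  moreover have "ln (1 - K * (1 + e)) < - (K * (1 + e))"
    using ln_less_minus_one[OF V] \<open>0 < K\<close> \<open>0 < 1 + e\<close> by simp
  then have "(1 - q) * ln (1 - K * (1 + e)) < (1 - q) * (- (K * (1 + e)))"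
    using \<open>q < 1\<close> by (intro mult_strict_left_mono) auto
  moreover have "q * (K * (a - 1 - e)) + (1 - q) * (- (K * (1 + e))) = K * (a * q - (1 + e))"
    by (simp add: algebra_simps)
  moreover have "K * (a * q - (1 + e)) \<le> 0"
    using \<open>0 < K\<close> \<open>a * q \<le> 1 + e\<close> by (simp add: mult_le_0_iff)
  ultimately show ?thesis
    by linarith
qed

text \<open>\<open>U'\<close> and \<open>V'\<close> are the values of \<open>U\<close> and
  \<open>V\<close> at the claimed maximizer. Tangent bounds for \<open>U / U'\<close> and
  \<open>V / V'\<close>, weighted by \<open>q\<close> and \<open>1 - q\<close>, add up to 0; the
  first is strict because \<open>U\<close> determines \<open>K\<close>.\<close>

lemma log_growth_less_optimum:
  fixes a e q K :: real
  assumes "0 < q" "q \<le> 1" "0 < 1 + e" "1 + e < a"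
    and U: "0 < 1 + K * (a - 1 - e)" and V: "0 \<le> 1 - K * (1 + e)"
    and interior: "q < 1 \<Longrightarrow> 1 - K * (1 + e) \<noteq> 0"
    and K: "K \<noteq> (a * q - e - 1) / ((e + 1) * (a - e - 1))"
  shows "q * ln (1 + K * (a - 1 - e)) + (1 - q) * ln (1 - K * (1 + e))
    < q * ln (a * q / (e + 1)) + (1 - q) * ln (a * (1 - q) / (a - e - 1))"
proof -
  define U where "U = 1 + K * (a - 1 - e)"
  define V where "V = 1 - K * (1 + e)"
  define U' where "U' = a * q / (e + 1)"
  define V' where "V' = a * (1 - q) / (a - e - 1)"
  have pos: "0 < U" "0 < U'" "0 < a"
    using assms by (auto simp: U_def U'_def)
  have "U \<noteq> U'"
  proof
    assume "U = U'"
    then have "K * (a - e - 1) = (a * q - e - 1) / (e + 1)"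
      using \<open>0 < 1 + e\<close> by (simp add: U_def U'_def field_simps)
    then have "K = (a * q - e - 1) / (e + 1) / (a - e - 1)"
      using \<open>1 + e < a\<close> by (subst nonzero_eq_divide_eq) auto
    then have "K = (a * q - e - 1) / ((e + 1) * (a - e - 1))"
      by (simp only: divide_divide_eq_left)
    with K show False ..
  qed
  have "ln U - ln U' < U / U' - 1"
    using ln_less_minus_one[of "U / U'"] pos \<open>U \<noteq> U'\<close> by (simp add: ln_div)
  then have "q * (ln U - ln U') < q * (U / U' - 1)"
    using \<open>0 < q\<close> by simp
  \<comment> \<open>The choice of \<open>U'\<close> makes \<open>q / U'\<close> equal to
    \<open>(1 + e) / a\<close>, which no longer depends on \<open>q\<close>.\<close>
  also have "\<dots> = U * (1 + e) / a - q"
    using \<open>0 < q\<close> \<open>0 < a\<close> \<open>0 < 1 + e\<close> by (simp add: U'_def field_simps)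
  finally have 1: "q * (ln U - ln U') < U * (1 + e) / a - q" .
  have 2: "(1 - q) * (ln V - ln V') \<le> V * (a - e - 1) / a - (1 - q)"
  proof (cases "q = 1")
    case True
    then show ?thesis
      using V \<open>0 < a\<close> \<open>1 + e < a\<close> by (simp add: V_def)
  next
    case False
    then have "q < 1" "0 < V" "0 < V'"
      using assms \<open>0 < a\<close> by (auto simp: V_def V'_def)
    have "(1 - q) * (ln V - ln V') \<le> (1 - q) * (V / V' - 1)"
      using ln_le_minus_one[of "V / V'"] \<open>0 < V\<close> \<open>0 < V'\<close> \<open>q < 1\<close>
      by (intro mult_left_mono) (auto simp: ln_div)
    also have "\<dots> = V * (a - e - 1) / a - (1 - q)"
      using \<open>q < 1\<close> \<open>0 < a\<close> \<open>1 + e < a\<close> by (simp add: V'_def divide_simps)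
    finally show ?thesis .
  qed
  \<comment> \<open>In this combination \<open>K\<close> cancels, so the two upper bounds sum to
    \<open>1 - q - (1 - q) = 0\<close>.\<close>
  have "U * (1 + e) + V * (a - e - 1) = a"
    by (simp add: U_def V_def algebra_simps)
  then have 3: "U * (1 + e) / a + V * (a - e - 1) / a = 1"
    using \<open>0 < a\<close> by (simp add: add_divide_distrib[symmetric])
  have "q * ln U + (1 - q) * ln V < q * ln U' + (1 - q) * ln V'"
    using 1 2 3 unfolding right_diff_distrib by linarith
  then show ?thesis
    unfolding U_def V_def U'_def V'_def .
qed

section \<open>The optimal Kelly fraction and growth rate\<close>

theorem theorem2:
  fixes M :: "'a measure" and X :: "nat \<Rightarrow> 'a \<Rightarrow> real"
    and p \<epsilon> :: real and n :: nat
  assumes "prob_space M"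
    and "1 / 2 < p" and "p \<le> 1"
    and "0 < \<epsilon>" and "\<epsilon> < 1"
    and "n \<ge> 1"
    and "prob_space.indep_vars M (\<lambda>_. borel) X UNIV"
    and "\<And>k. measure M {\<omega> \<in> space M. X k \<omega> = 1} = p"
    and "\<And>k. measure M {\<omega> \<in> space M. X k \<omega> = -1} = 1 - p"
  shows "(\<exists>!K. is_kelly_fraction M X n \<epsilon> K)
    \<and> growth_rate M X n \<epsilon> (kelly_fraction M X n \<epsilon>) = optimal_growth_rate M X n \<epsilon>
    \<and> (p \<le> p_threshold n \<epsilon> \<longrightarrow>
         kelly_fraction M X n \<epsilon> = 0 \<and> optimal_growth_rate M X n \<epsilon> = 0)
    \<and> (\<not> p \<le> p_threshold n \<epsilon> \<longrightarrow>
         kelly_fraction M X n \<epsilon> = (2 ^ n * p ^ n - \<epsilon> - 1) / ((\<epsilon> + 1) * (2 ^ n - \<epsilon> - 1))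
       \<and> optimal_growth_rate M X n \<epsilon> = ereal (1 / real n *
           (p ^ n * ln (2 ^ n * p ^ n / (\<epsilon> + 1))
            + (1 - p ^ n) * ln (2 ^ n * (1 - p ^ n) / (2 ^ n - \<epsilon> - 1)))))"
proof -
  interpret prob_space M by fact
  define q where "q = p ^ n"
  have "0 < q" "q \<le> 1"
    using assms(2,3) by (auto simp: q_def power_le_one)
  \<comment> \<open>Since \<open>n \<ge> 1\<close>, the bound \<open>1 + \<epsilon> < 2\<close>
    suffices to make \<open>2 ^ n - 1 - \<epsilon>\<close> positive.\<close>
  have "(2::real) ^ 1 \<le> 2 ^ n"
    using \<open>n \<ge> 1\<close> by (intro power_increasing) auto
  then have a: "1 + \<epsilon> < 2 ^ n"
    using \<open>\<epsilon> < 1\<close> by simp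
  have bounds: "0 \<le> K" "0 < 1 + K * (2 ^ n - 1 - \<epsilon>)" "0 \<le> 1 - K * (1 + \<epsilon>)"
    if "K \<in> admissible \<epsilon>" for K
  proof -
    show "0 \<le> K" "0 \<le> 1 - K * (1 + \<epsilon>)"
      using that \<open>0 < \<epsilon>\<close> by (auto simp: admissible_def field_simps)
    with a show "0 < 1 + K * (2 ^ n - 1 - \<epsilon>)"
      by (intro add_pos_nonneg mult_nonneg_nonneg) auto
  qed
  have growth: "growth_rate M X n \<epsilon> K =
      (if q < 1 \<and> 1 - K * (1 + \<epsilon>) = 0 then -\<infinity>
       else ereal (1 / real n * (q * ln (1 + K * (2 ^ n - 1 - \<epsilon>))
                                 + (1 - q) * ln (1 - K * (1 + \<epsilon>)))))"
    if "K \<in> admissible \<epsilon>" for K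
    unfolding q_def by (rule growth_rate_coin) (use assms bounds[OF that] in auto)
  have threshold: "p \<le> p_threshold n \<epsilon> \<longleftrightarrow> 2 ^ n * q \<le> 1 + \<epsilon>"
    unfolding q_def using assms by (intro le_p_threshold_iff) auto
  show ?thesis
  proof (cases "2 ^ n * q \<le> 1 + \<epsilon>")
    case True
    \<comment> \<open>With \<open>q = 1\<close> the case assumption would read
      \<open>2 ^ n \<le> 1 + \<epsilon>\<close>.\<close>
    have "q < 1"
      using True a \<open>q \<le> 1\<close> by (cases "q = 1") auto
    have "0 \<in> admissible \<epsilon>"
      using \<open>0 < \<epsilon>\<close> by (simp add: admissible_def)
    then have zero: "growth_rate M X n \<epsilon> 0 = 0"
      by (simp add: growth)
    have "growth_rate M X n \<epsilon> K < growth_rate M X n \<epsilon> 0"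
      if K: "K \<in> admissible \<epsilon>" "K \<noteq> 0" for K
    \<comment> \<open>The right endpoint of the admissible interval has growth rate minus infinity,
      as ruin has positive probability there.\<close>
    proof (cases "1 - K * (1 + \<epsilon>) = 0")
      case True
      then show ?thesis
        unfolding zero growth[OF K(1)] using \<open>q < 1\<close> by simp
    next
      case False
      then have "q * ln (1 + K * (2 ^ n - 1 - \<epsilon>)) + (1 - q) * ln (1 - K * (1 + \<epsilon>)) < 0"
        using bounds[OF K(1)] K(2) \<open>0 < q\<close> \<open>q < 1\<close> \<open>2 ^ n * q \<le> 1 + \<epsilon>\<close> \<open>0 < \<epsilon>\<close>
        by (intro log_growth_less_zero) auto
      then show ?thesis
        unfolding zero growth[OF K(1)] using False \<open>n \<ge> 1\<close>
        by (simp add: divide_less_0_iff)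
    qed
    then have "\<forall>K \<in> admissible \<epsilon> - {0}. growth_rate M X n \<epsilon> K < growth_rate M X n \<epsilon> 0"
      by blast
    note kelly = kelly_fraction_eqI[OF \<open>0 \<in> admissible \<epsilon>\<close> this]
    show ?thesis
      using True by (simp add: kelly zero threshold)
  next
    case False
    define L where "L = (2 ^ n * q - \<epsilon> - 1) / ((\<epsilon> + 1) * (2 ^ n - \<epsilon> - 1))"
    define G where "G = q * ln (2 ^ n * q / (\<epsilon> + 1))
      + (1 - q) * ln (2 ^ n * (1 - q) / (2 ^ n - \<epsilon> - 1))"
    \<comment> \<open>The two account values at \<open>L\<close> are exactly the arguments of the
      logarithms in \<open>G\<close>. The second one also yields
      \<open>L \<le> 1 / (1 + \<epsilon>)\<close>.\<close>
    have U: "1 + L * (2 ^ n - 1 - \<epsilon>) = 2 ^ n * q / (\<epsilon> + 1)"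
    proof -
      have "L * (2 ^ n - \<epsilon> - 1) = (2 ^ n * q - \<epsilon> - 1) / (\<epsilon> + 1)"
        using a by (simp add: L_def)
      then show ?thesis
        using \<open>0 < \<epsilon>\<close> by (simp add: field_simps)
    qed
    have V: "1 - L * (1 + \<epsilon>) = 2 ^ n * (1 - q) / (2 ^ n - \<epsilon> - 1)"
    proof -
      have "L * (1 + \<epsilon>) = (2 ^ n * q - \<epsilon> - 1) / (2 ^ n - \<epsilon> - 1)"
        using \<open>0 < \<epsilon>\<close> by (simp add: L_def add.commute)
      then show ?thesis
        using a by (simp add: field_simps)
    qed
    have "0 \<le> L"
      using False a \<open>0 < \<epsilon>\<close> by (simp add: L_def)
    moreover have "0 \<le> 1 - L * (1 + \<epsilon>)"
      unfolding V using a \<open>q \<le> 1\<close> by simp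
    ultimately have L: "L \<in> admissible \<epsilon>"
      using \<open>0 < \<epsilon>\<close> by (simp add: admissible_def field_simps)
    \<comment> \<open>The infinite branch does not occur at \<open>L\<close>: by \<open>V\<close>,
      the losing account value is positive if \<open>q < 1\<close>. If \<open>q = 1\<close>, then
      \<open>L\<close> is the right endpoint and the growth rate is still finite.\<close>
    have opt: "growth_rate M X n \<epsilon> L = ereal (1 / real n * G)"
      unfolding growth[OF L] U V G_def using a by auto
    have "growth_rate M X n \<epsilon> K < growth_rate M X n \<epsilon> L"
      if K: "K \<in> admissible \<epsilon>" "K \<noteq> L" for K
    proof (cases "q < 1 \<and> 1 - K * (1 + \<epsilon>) = 0")
      case True
      then show ?thesis
        unfolding opt growth[OF K(1)] by simp
    next
      case False
      then have "q * ln (1 + K * (2 ^ n - 1 - \<epsilon>)) + (1 - q) * ln (1 - K * (1 + \<epsilon>)) < G"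
        unfolding G_def using bounds[OF K(1)] K(2) \<open>0 < q\<close> \<open>q \<le> 1\<close> \<open>0 < \<epsilon>\<close> a
        by (intro log_growth_less_optimum) (auto simp: L_def)
      then have "1 / real n * (q * ln (1 + K * (2 ^ n - 1 - \<epsilon>)) + (1 - q) * ln (1 - K * (1 + \<epsilon>)))
          < 1 / real n * G"
        using \<open>n \<ge> 1\<close> by (intro mult_strict_left_mono) auto
      then show ?thesis
        unfolding opt growth[OF K(1)] using False by (simp only: if_False less_ereal.simps)
    qed
    then have "\<forall>K \<in> admissible \<epsilon> - {L}. growth_rate M X n \<epsilon> K < growth_rate M X n \<epsilon> L"
      by blast
    note kelly = kelly_fraction_eqI[OF L this]
    show ?thesis
      using False kelly(1) unfolding q_def[symmetric] threshold kelly(2,3) opt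
      by (simp add: L_def G_def)
  qed
qed

end
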